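(* Let $0<a<1$ and $\phi_a(z)=az+(1-a)$. Let $f\in H^2$ be non-zero and such that $K_f$ is a minimal invariant subspace for $C_{\phi_a}$. Then $K_f$ has a generator (that is, there is $g\in H^2$ with $K_g=K_f$) that is analytic on a neighborhood of $\overline{\mathbb{D}}\setminus\{1\}$. Moreover, for any given compact subset $L$ of the half-plane $\mathbb{H}=\{z\in\mathbb{C}:\mathrm{Re}(z)<1\}$, the generator and this neighborhood can be chosen so that the neighborhood contains $L$.
   Context: $H^2=H^2(\mathbb{D})$ is the Hardy space of the open unit disk $\mathbb{D}$. $C_{\phi_a}f=f\circ\phi_a$ is a bounded operator on $H^2$. For non-zero $f\in H^2$, $K_f=\overline{\mathrm{span}\{C_{\phi_a}^n f:n\ge0\}}^{H^2}$. An invariant subspace is a closed subspace mapped into itself; it is minimal if it is non-zero and contains no invariant subspaces other than $\{0\}$ and itself. A function in $H^2$ is analytic on an open set $V\supset\overline{\mathbb{D}}\setminus\{1\}$ if it extends analytically from $\mathbb{D}$ to $V$. *)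

theory Defs
  imports "HOL-Complex_Analysis.Complex_Analysis" "HOL-Library.Function_Algebras"
begin

text \<open>Complex-valued functions form a complex vector space under the pointwise operations
  of \<^theory>\<open>HOL-Library.Function_Algebras\<close>. The library constant \<^const>\<open>span\<close> is the real-linear
  span, so the complex-linear notions are obtained by interpreting \<^locale>\<open>vector_space\<close>.\<close>

definition cfun_scale :: "complex \<Rightarrow> ('a \<Rightarrow> complex) \<Rightarrow> 'a \<Rightarrow> complex" where
  "cfun_scale c f = (\<lambda>z. c * f z)"

global_interpretation cfun: vector_space cfun_scale
  defines cfun_span = cfun.span and cfun_subspace = cfun.subspace
  by unfold_locales (auto simp: cfun_scale_def fun_eq_iff algebra_simps)


definition circle_mean :: "(complex \<Rightarrow> complex) \<Rightarrow> real \<Rightarrow> real" where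
  "circle_mean f r = integral {0..2 * pi} (\<lambda>t. (cmod (f (of_real r * cis t)))\<^sup>2) / (2 * pi)"

text \<open>Elements of \<open>H\<^sup>2\<close> are functions on the open unit disk. They are represented by total
  functions vanishing off the disk, so that equality in \<open>H\<^sup>2\<close> is equality in HOL.\<close>

definition hardy2 :: "(complex \<Rightarrow> complex) set" where
  "hardy2 = {f. f holomorphic_on ball 0 1 \<and> (\<forall>z. z \<notin> ball 0 1 \<longrightarrow> f z = 0) \<and>
                bdd_above (circle_mean f ` {0..<1})}"

definition hardy2_norm :: "(complex \<Rightarrow> complex) \<Rightarrow> real" where
  "hardy2_norm f = sqrt (SUP r\<in>{0..<1}. circle_mean f r)"

text \<open>The guard is needed because \<^locale>\<open>Metric_space\<close> requires nonnegativity also off the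
  carrier, where the supremum of an unbounded set is unspecified.\<close>

definition hardy2_dist :: "(complex \<Rightarrow> complex) \<Rightarrow> (complex \<Rightarrow> complex) \<Rightarrow> real" where
  "hardy2_dist f g = (if f \<in> hardy2 \<and> g \<in> hardy2 then hardy2_norm (f - g) else 0)"

lemma circle_mean_integrable:
  assumes "f holomorphic_on ball 0 1" "0 \<le> r" "r < 1"
  shows "continuous_on {0..2*pi} (\<lambda>t. (cmod (f (of_real r * cis t)))\<^sup>2)"
    and "(\<lambda>t. (cmod (f (of_real r * cis t)))\<^sup>2) integrable_on {0..2*pi}"
proof -
  have c: "continuous_on (ball 0 1) f"
    using assms(1) by (rule holomorphic_on_imp_continuous_on)
  show *: "continuous_on {0..2*pi} (\<lambda>t. (cmod (f (of_real r * cis t)))\<^sup>2)"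
    by (intro continuous_intros continuous_on_compose2[OF c])
      (use assms in \<open>auto simp: norm_mult\<close>)
  show "(\<lambda>t. (cmod (f (of_real r * cis t)))\<^sup>2) integrable_on {0..2*pi}"
    by (rule integrable_continuous_interval[OF *])
qed

lemma circle_mean_nonneg: "0 \<le> circle_mean f r"
proof (cases "(\<lambda>t. (cmod (f (of_real r * cis t)))\<^sup>2) integrable_on {0..2*pi}")
  case True
  then show ?thesis
    unfolding circle_mean_def by (intro divide_nonneg_nonneg integral_nonneg) auto
next
  case False
  then show ?thesis by (simp add: circle_mean_def not_integrable_integral)
qed

lemma circle_mean_le_norm:
  assumes "f \<in> hardy2" "0 \<le> r" "r < 1"
  shows "circle_mean f r \<le> (hardy2_norm f)\<^sup>2"
proof -
  have le: "circle_mean f r \<le> (SUP r\<in>{0..<1}. circle_mean f r)"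
    using assms by (intro cSUP_upper) (auto simp: hardy2_def)
  then show ?thesis
    using circle_mean_nonneg[of f r] by (simp add: hardy2_norm_def)
qed

lemma hardy2_norm_nonneg:
  assumes "f \<in> hardy2"
  shows "0 \<le> hardy2_norm f"
proof -
  have "circle_mean f 0 \<le> (SUP r\<in>{0..<1}. circle_mean f r)"
    using assms by (intro cSUP_upper) (auto simp: hardy2_def)
  then show ?thesis
    using circle_mean_nonneg[of f 0] by (simp add: hardy2_norm_def)
qed

lemma norm_diff_square_le:
  fixes u v :: complex and x y :: real
  assumes "x > 0" "y > 0"
  shows "(cmod (u - v))\<^sup>2 \<le> (x + y) / x * (cmod u)\<^sup>2 + (x + y) / y * (cmod v)\<^sup>2"
proof -
  have "(cmod (u - v))\<^sup>2 \<le> (cmod u + cmod v)\<^sup>2"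
    by (intro power_mono norm_triangle_ineq4) auto
  also have "\<dots> \<le> (x + y) / x * (cmod u)\<^sup>2 + (x + y) / y * (cmod v)\<^sup>2"
  proof -
    have "0 \<le> (y * cmod u - x * cmod v)\<^sup>2 / (x * y)"
      using assms by auto
    also have "\<dots> = (x + y) / x * (cmod u)\<^sup>2 + (x + y) / y * (cmod v)\<^sup>2 - (cmod u + cmod v)\<^sup>2"
      using assms by (simp add: field_simps power2_eq_square)
    finally show ?thesis by simp
  qed
  finally show ?thesis .
qed

lemma circle_mean_diff_le:
  assumes f: "f \<in> hardy2" and g: "g \<in> hardy2" and r: "0 \<le> r" "r < 1"
  shows "circle_mean (f - g) r \<le> (hardy2_norm f + hardy2_norm g)\<^sup>2"
proof -
  have hol: "f holomorphic_on ball 0 1" "g holomorphic_on ball 0 1" "(f - g) holomorphic_on ball 0 1"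
    using f g by (auto simp: hardy2_def fun_diff_def intro!: holomorphic_intros)
  have bound: "circle_mean (f - g) r \<le> (x + y)\<^sup>2"
    if x: "x > hardy2_norm f" and y: "y > hardy2_norm g" for x y
  proof -
    have pos: "x > 0" "y > 0"
      using x y hardy2_norm_nonneg[OF f] hardy2_norm_nonneg[OF g] by auto
    let ?u = "\<lambda>t. (cmod (f (of_real r * cis t)))\<^sup>2" and ?v = "\<lambda>t. (cmod (g (of_real r * cis t)))\<^sup>2"
    have intf: "?u integrable_on {0..2*pi}" "?v integrable_on {0..2*pi}"
      using circle_mean_integrable(2) hol r by blast+
    have "integral {0..2*pi} (\<lambda>t. (cmod ((f - g) (of_real r * cis t)))\<^sup>2)
        \<le> integral {0..2*pi} (\<lambda>t. (x + y) / x * ?u t + (x + y) / y * ?v t)"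
      using circle_mean_integrable(2)[OF hol(3) r] norm_diff_square_le[OF pos] intf
      by (intro integral_le integrable_add integrable_on_mult_right) auto
    also have "\<dots> = (x + y) / x * integral {0..2*pi} ?u + (x + y) / y * integral {0..2*pi} ?v"
      by (simp only: integral_add[OF integrable_on_mult_right[OF intf(1)] integrable_on_mult_right[OF intf(2)]]
          integral_mult_right)
    finally have "circle_mean (f - g) r
        \<le> ((x + y) / x * integral {0..2*pi} ?u + (x + y) / y * integral {0..2*pi} ?v) / (2 * pi)"
      unfolding circle_mean_def by (intro divide_right_mono) auto
    also have "\<dots> = (x + y) / x * circle_mean f r + (x + y) / y * circle_mean g r"
      unfolding circle_mean_def by (simp add: add_divide_distrib)
    also have "\<dots> \<le> (x + y) / x * x\<^sup>2 + (x + y) / y * y\<^sup>2"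
    proof (intro add_mono mult_left_mono)
      show "circle_mean f r \<le> x\<^sup>2"
        using circle_mean_le_norm[OF f r] power_mono[of "hardy2_norm f" x 2] x hardy2_norm_nonneg[OF f]
        by linarith
      show "circle_mean g r \<le> y\<^sup>2"
        using circle_mean_le_norm[OF g r] power_mono[of "hardy2_norm g" y 2] y hardy2_norm_nonneg[OF g]
        by linarith
    qed (use pos in auto)
    also have "\<dots> = (x + y)\<^sup>2"
      using pos by (simp add: field_simps power2_eq_square)
    finally show ?thesis .
  qed
  have lim: "((\<lambda>e. (hardy2_norm f + e + (hardy2_norm g + e))\<^sup>2)
      \<longlongrightarrow> (hardy2_norm f + 0 + (hardy2_norm g + 0))\<^sup>2) (at_right 0)"
    by (intro tendsto_intros)
  have ev: "\<forall>\<^sub>F e in at_right 0. circle_mean (f - g) r \<le> (hardy2_norm f + e + (hardy2_norm g + e))\<^sup>2"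
    using eventually_at_right_less[of "0::real"] by eventually_elim (rule bound; simp)
  from tendsto_lowerbound[OF lim ev] show ?thesis by simp
qed

lemma hardy2_diff:
  assumes f: "f \<in> hardy2" and g: "g \<in> hardy2"
  shows "f - g \<in> hardy2"
proof -
  have "bdd_above (circle_mean (f - g) ` {0..<1})"
    using circle_mean_diff_le[OF f g] by (intro bdd_aboveI[of _ "(hardy2_norm f + hardy2_norm g)\<^sup>2"]) auto
  then show ?thesis
    using f g by (auto simp: hardy2_def fun_diff_def intro!: holomorphic_intros)
qed

lemma hardy2_norm_diff_le:
  assumes f: "f \<in> hardy2" and g: "g \<in> hardy2"
  shows "hardy2_norm (f - g) \<le> hardy2_norm f + hardy2_norm g"
proof -
  have "(SUP r\<in>{0..<1}. circle_mean (f - g) r) \<le> (hardy2_norm f + hardy2_norm g)\<^sup>2"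
    using circle_mean_diff_le[OF f g] by (intro cSUP_least) auto
  then have "sqrt (SUP r\<in>{0..<1}. circle_mean (f - g) r) \<le> sqrt ((hardy2_norm f + hardy2_norm g)\<^sup>2)"
    by (rule real_sqrt_le_mono)
  then show ?thesis
    using hardy2_norm_nonneg[OF f] hardy2_norm_nonneg[OF g] by (simp add: hardy2_norm_def[of "f - g"])
qed

lemma hardy2_norm_zero: "hardy2_norm 0 = 0"
  by (simp add: hardy2_norm_def circle_mean_def)

lemma hardy2_norm_eq_0D:
  assumes f: "f \<in> hardy2" and "hardy2_norm f = 0"
  shows "f = 0"
proof
  fix z
  show "f z = 0 z"
  proof (cases "z \<in> ball 0 1")
    case True
    define r where "r = cmod z"
    have r: "0 \<le> r" "r < 1"
      using True by (auto simp: r_def)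
    have hol: "f holomorphic_on ball 0 1"
      using f by (simp add: hardy2_def)
    have "circle_mean f r = 0"
      using circle_mean_le_norm[OF f r] circle_mean_nonneg[of f r] assms(2) by simp
    then have "integral {0..2*pi} (\<lambda>t. (cmod (f (of_real r * cis t)))\<^sup>2) = 0"
      by (simp add: circle_mean_def)
    then have "\<forall>t\<in>{0..2*pi}. (cmod (f (of_real r * cis t)))\<^sup>2 = 0"
      using integral_eq_0_iff[OF circle_mean_integrable(1)[OF hol r]] by simp
    moreover have "Arg2pi z \<in> {0..2*pi}"
      using Arg2pi[of z] by simp
    ultimately have "f (of_real r * cis (Arg2pi z)) = 0"
      by auto
    moreover have "z = of_real r * cis (Arg2pi z)"
      using Arg2pi_eq[of z] by (simp add: r_def cis_conv_exp)
    ultimately show ?thesis by simp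
  next
    case False
    then show ?thesis using f by (simp add: hardy2_def)
  qed
qed

lemma hardy2_norm_minus_commute: "hardy2_norm (f - g) = hardy2_norm (g - f)"
  by (simp add: hardy2_norm_def circle_mean_def norm_minus_commute)

global_interpretation hardy2: Metric_space hardy2 hardy2_dist
proof
  show "0 \<le> hardy2_dist f g" for f g
    by (simp add: hardy2_dist_def hardy2_norm_nonneg hardy2_diff)
  show "hardy2_dist f g = hardy2_dist g f" for f g
    by (simp add: hardy2_dist_def hardy2_norm_minus_commute)
  show "hardy2_dist f g = 0 \<longleftrightarrow> f = g" if "f \<in> hardy2" "g \<in> hardy2" for f g
    using that hardy2_norm_eq_0D[OF hardy2_diff] hardy2_norm_zero by (auto simp: hardy2_dist_def)
  show "hardy2_dist f h \<le> hardy2_dist f g + hardy2_dist g h"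
    if "f \<in> hardy2" "g \<in> hardy2" "h \<in> hardy2" for f g h
  proof -
    have "(f - g) - (h - g) = f - h"
      by simp
    then show ?thesis
      using hardy2_norm_diff_le[OF hardy2_diff[OF that(1,2)] hardy2_diff[OF that(3,2)]] that
      by (simp only: hardy2_dist_def hardy2_norm_minus_commute[of h g] simp_thms if_True)
  qed
qed


definition comp_op :: "(complex \<Rightarrow> complex) \<Rightarrow> (complex \<Rightarrow> complex) \<Rightarrow> complex \<Rightarrow> complex" where
  "comp_op \<phi> f = (\<lambda>z. if z \<in> ball 0 1 then f (\<phi> z) else 0)"

definition affine_symbol :: "real \<Rightarrow> complex \<Rightarrow> complex" where
  "affine_symbol a z = of_real a * z + (1 - of_real a)"

definition cyclic_subspace ::
  "((complex \<Rightarrow> complex) \<Rightarrow> complex \<Rightarrow> complex) \<Rightarrow> (complex \<Rightarrow> complex) \<Rightarrow> (complex \<Rightarrow> complex) set" where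
  "cyclic_subspace T f = hardy2.mtopology closure_of cfun_span {(T ^^ n) f |n. True}"

definition invariant_subspace ::
  "((complex \<Rightarrow> complex) \<Rightarrow> complex \<Rightarrow> complex) \<Rightarrow> (complex \<Rightarrow> complex) set \<Rightarrow> bool" where
  "invariant_subspace T M \<longleftrightarrow>
     cfun_subspace M \<and> closedin hardy2.mtopology M \<and> T ` M \<subseteq> M"

definition minimal_invariant_subspace ::
  "((complex \<Rightarrow> complex) \<Rightarrow> complex \<Rightarrow> complex) \<Rightarrow> (complex \<Rightarrow> complex) set \<Rightarrow> bool" where
  "minimal_invariant_subspace T M \<longleftrightarrow> invariant_subspace T M \<and> M \<noteq> {0} \<and>
     (\<forall>N. invariant_subspace T N \<and> N \<subseteq> M \<longrightarrow> N = {0} \<or> N = M)"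

text \<open>The values of \<open>g\<close> off the disk are only a convention, so analyticity on a larger set is
  expressed through an extension \<open>G\<close>.\<close>

definition extends_analytically :: "(complex \<Rightarrow> complex) \<Rightarrow> complex set \<Rightarrow> bool" where
  "extends_analytically g V \<longleftrightarrow> (\<exists>G. G analytic_on V \<and> (\<forall>z\<in>ball 0 1. G z = g z))"

end

theory Submission
  imports Defs
begin

text \<open>Write \<open>T\<close> for the operator of composition with \<open>\<phi>\<^sub>a\<close>. The generator is \<open>g = T\<^sup>n f\<close> for \<open>n\<close> large.
  Since the iterates of \<open>\<phi>\<^sub>a\<close> are again affine, \<open>T\<^sup>n f = f \<circ> \<phi>\<^sub>c\<close> with \<open>c = a\<^sup>n\<close>
  (lemma \<open>comp_affine_symbol_funpow\<close>), and this
  extends analytically to the preimage of the unit disk under \<open>\<phi>\<^sub>c\<close>. That preimage is the disk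
  of radius \<open>1 / c\<close> that touches the line \<open>Re z = 1\<close> from the left at \<open>1\<close>; it contains the closed unit
  disk except for \<open>1\<close>, and as \<open>c\<close> tends to \<open>0\<close> it swallows every compact subset of the half-plane
  \<open>Re z < 1\<close> (lemma \<open>compact_subset_affine_vimage\<close>).

  It remains to see that \<open>g\<close> generates the same subspace as \<open>f\<close>. A nonzero element \<open>g\<close> of a minimal
  invariant subspace \<open>M\<close> generates \<open>M\<close>, because its cyclic subspace is a nonzero invariant subspace
  of \<open>M\<close> (lemma \<open>minimal_invariant_subspace_cyclic\<close>). And \<open>T\<^sup>n f\<close> is nonzero because, by the
  identity theorem, \<open>f\<close> cannot vanish on the open image of \<open>\<phi>\<^sub>c\<close>.

  The analytic input is that \<open>T\<close> is bounded on the Hardy space: without continuity of \<open>T\<close> the closed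
  span of an orbit need not be invariant. A circle about the origin is mapped by \<open>\<phi>\<^sub>a\<close> to a circle
  about \<open>1 - a\<close>. On the latter, \<open>\<bar>f\<bar>\<^sup>2\<close> is dominated by the Poisson integral of its values on a large
  circle about the origin; averaging the Poisson kernel over the small circle gives its value at
  \<open>1 - a\<close>, and Harnack's inequality bounds that value
  (lemma \<open>circle_integral_off_center_le\<close>).\<close>

section \<open>Poisson integrals on circles\<close>

text \<open>Cauchy's formula in angular form; the measure \<open>dt\<close> replaces \<open>du / (\<i> (u - c))\<close>, so that real and imaginary
  parts and absolute values can be taken under the integral sign.\<close>

lemma Cauchy_integral_circle:
  assumes "F holomorphic_on cball c r" "cmod (w - c) < r"
  shows "((\<lambda>t. F (c + of_real r * cis t) * (of_real r * cis t) / (c + of_real r * cis t - w))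
            has_integral of_real (2 * pi) * F w) {0..2 * pi}"
proof -
  have "((\<lambda>u. F u / (u - w)) has_contour_integral 2 * of_real pi * \<i> * F w)
          (part_circlepath c r 0 (2 * pi))"
    using Cauchy_integral_circlepath_simple[OF assms] by (simp add: circlepath_def)
  then have "((\<lambda>t. F (c + of_real r * cis t) / (c + of_real r * cis t - w) * of_real r * \<i> * cis t)
          has_integral 2 * of_real pi * \<i> * F w) {0..2 * pi}"
    by (subst (asm) has_contour_integral_part_circlepath_iff) auto
  from has_integral_mult_right[OF this, of "-\<i>"]
  show ?thesis
    by (simp add: mult_ac)
qed

lemma holomorphic_circle_mean_value:
  assumes "F holomorphic_on cball c r" "0 \<le> r"
  shows "((\<lambda>t. F (c + of_real r * cis t)) has_integral of_real (2 * pi) * F c) {0..2 * pi}"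
proof (cases "r = 0")
  case True
  then show ?thesis
    using has_integral_const_real[of "F c" 0 "2 * pi"] by (simp add: scaleR_conv_of_real)
next
  case False
  then show ?thesis
    using Cauchy_integral_circle[OF assms(1), of c] assms(2) by simp
qed

definition poisson_kernel :: "complex \<Rightarrow> complex \<Rightarrow> real" where
  "poisson_kernel \<zeta> w = ((cmod \<zeta>)\<^sup>2 - (cmod w)\<^sup>2) / (cmod (\<zeta> - w))\<^sup>2"

text \<open>As the real part of a function holomorphic in \<open>w\<close>, the kernel inherits the mean value property
  of holomorphic functions.\<close>

lemma poisson_kernel_eq_Re: "poisson_kernel \<zeta> w = Re ((\<zeta> + w) / (\<zeta> - w))"
  unfolding poisson_kernel_def Re_divide' cmod_power2
  by (simp add: algebra_simps power2_eq_square)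

text \<open>The upper half of Harnack's inequality.\<close>

lemma poisson_kernel_le:
  assumes "cmod w < cmod \<zeta>"
  shows "poisson_kernel \<zeta> w \<le> (cmod \<zeta> + cmod w) / (cmod \<zeta> - cmod w)"
proof -
  have "poisson_kernel \<zeta> w \<le> ((cmod \<zeta>)\<^sup>2 - (cmod w)\<^sup>2) / (cmod \<zeta> - cmod w)\<^sup>2"
    unfolding poisson_kernel_def using assms norm_triangle_ineq2[of \<zeta> w]
    by (intro divide_left_mono power_mono mult_pos_pos) (auto simp: power_strict_mono less_imp_le)
  also have "\<dots> = (cmod \<zeta> + cmod w) / (cmod \<zeta> - cmod w)"
    using assms by (simp add: power2_eq_square square_diff_square_factored)
  finally show ?thesis .
qed

lemma poisson_kernel_mean_value:
  assumes "0 \<le> q" "cmod c + q < cmod \<zeta>"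
  shows "((\<lambda>s. poisson_kernel \<zeta> (c + of_real q * cis s))
            has_integral 2 * pi * poisson_kernel \<zeta> c) {0..2 * pi}"
proof -
  have "\<zeta> - w \<noteq> 0" if "w \<in> cball c q" for w
    using that assms norm_triangle_ineq2[of w c] by (auto simp: dist_norm norm_minus_commute)
  then have "(\<lambda>w. (\<zeta> + w) / (\<zeta> - w)) holomorphic_on cball c q"
    by (intro holomorphic_intros) auto
  from has_integral_Re[OF holomorphic_circle_mean_value[OF this assms(1)]]
  moreover have "Re (of_real (2 * pi) * z) = 2 * pi * Re z" for z
    by simp
  ultimately show ?thesis
    unfolding poisson_kernel_eq_Re by (simp only:)
qed

text \<open>Subharmonicity of \<open>\<bar>f\<bar>\<^sup>2\<close> in Poisson form. Cauchy's formula at \<open>w\<close> is applied to \<open>f\<^sup>2\<close> divided by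
  \<open>\<rho>\<^sup>2 - cnj w * u\<close>: this denominator does not vanish on the disk of radius \<open>\<rho>\<close>, and on its boundary
  circle it combines with the Cauchy kernel into the positive weight \<open>1 / \<bar>\<zeta> - w\<bar>\<^sup>2\<close>. Since \<open>f\<^sup>2\<close> is
  holomorphic, taking absolute values then gives the bound for \<open>\<bar>f\<bar>\<^sup>2\<close>.\<close>

lemma square_le_poisson_integral:
  assumes hol: "f holomorphic_on ball 0 1" and "\<rho> < 1" "cmod w < \<rho>"
  shows "2 * pi * (cmod (f w))\<^sup>2 \<le>
    integral {0..2 * pi} (\<lambda>t. (cmod (f (of_real \<rho> * cis t)))\<^sup>2 * poisson_kernel (of_real \<rho> * cis t) w)"
proof -
  have \<rho>: "0 < \<rho>" using assms(3) norm_ge_zero[of w] by linarith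
  define K where "K = \<rho>\<^sup>2 - (cmod w)\<^sup>2"
  have K: "K > 0" using assms(3) \<rho> by (simp add: K_def power_strict_mono)
  have nz: "of_real (\<rho>\<^sup>2) - cnj w * u \<noteq> 0" if "u \<in> cball 0 \<rho>" for u
  proof
    assume "of_real (\<rho>\<^sup>2) - cnj w * u = 0"
    then have "cmod (cnj w * u) = \<rho>\<^sup>2" by (metis eq_iff_diff_eq_0 norm_of_real abs_power2 abs_of_nonneg zero_le_power2)
    moreover have "cmod (cnj w * u) \<le> cmod w * \<rho>"
      using that by (auto simp: norm_mult intro: mult_left_mono)
    moreover have "cmod w * \<rho> < \<rho>\<^sup>2"
      using assms(3) \<rho> by (simp add: power2_eq_square)
    ultimately show False by linarith
  qed
  define F where "F u = (f u)\<^sup>2 / (of_real (\<rho>\<^sup>2) - cnj w * u)" for u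
  have hol': "f holomorphic_on cball 0 \<rho>"
    using hol by (rule holomorphic_on_subset) (use assms(2) in auto)
  have "F holomorphic_on cball 0 \<rho>"
    unfolding F_def using nz by (intro holomorphic_intros hol') auto
  from Cauchy_integral_circle[OF this, of w] assms(3)
  have I: "((\<lambda>t. F (of_real \<rho> * cis t) * (of_real \<rho> * cis t) / (of_real \<rho> * cis t - w))
            has_integral of_real (2 * pi) * F w) {0..2 * pi}"
    by simp
  have Fw: "F w = (f w)\<^sup>2 / of_real K"
    by (simp add: F_def K_def complex_norm_square mult.commute flip: of_real_power)
  have ne: "\<zeta> - w \<noteq> 0" if "cmod \<zeta> = \<rho>" for \<zeta> using that assms(3) by auto
  have eq: "F \<zeta> * \<zeta> / (\<zeta> - w) = (f \<zeta>)\<^sup>2 / of_real ((cmod (\<zeta> - w))\<^sup>2)" if "cmod \<zeta> = \<rho>" for \<zeta>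
  proof -
    have "\<zeta> \<noteq> 0" using that \<rho> by auto
    have "of_real (\<rho>\<^sup>2) - cnj w * \<zeta> = \<zeta> * cnj (\<zeta> - w)"
      using that complex_norm_square[of \<zeta>] by (simp add: algebra_simps)
    then have "F \<zeta> * \<zeta> / (\<zeta> - w) = (f \<zeta>)\<^sup>2 / (cnj (\<zeta> - w) * (\<zeta> - w))"
      using \<open>\<zeta> \<noteq> 0\<close> unfolding F_def by simp
    also have "cnj (\<zeta> - w) * (\<zeta> - w) = of_real ((cmod (\<zeta> - w))\<^sup>2)"
      by (simp only: complex_norm_square mult.commute)
    finally show ?thesis .
  qed
  have cf: "continuous_on {0..2*pi} (\<lambda>t. f (of_real \<rho> * cis t))"
    by (intro continuous_intros continuous_on_compose2[OF holomorphic_on_imp_continuous_on[OF hol']])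
      (use \<rho> in \<open>auto simp: norm_mult\<close>)
  have pk: "(cmod (f \<zeta>))\<^sup>2 * poisson_kernel \<zeta> w = K * cmod (F \<zeta> * \<zeta> / (\<zeta> - w))"
    if "cmod \<zeta> = \<rho>" for \<zeta>
    unfolding eq[OF that] by (simp add: poisson_kernel_def that K_def norm_divide norm_power)
  have "cmod (of_real (2 * pi) * F w) \<le>
      integral {0..2 * pi} (\<lambda>t. (cmod (f (of_real \<rho> * cis t)))\<^sup>2 * poisson_kernel (of_real \<rho> * cis t) w / K)"
    unfolding integral_unique[OF I, symmetric]
  proof (rule integral_norm_bound_integral)
    show "(\<lambda>t. (cmod (f (of_real \<rho> * cis t)))\<^sup>2 * poisson_kernel (of_real \<rho> * cis t) w / K) integrable_on {0..2*pi}"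
      unfolding poisson_kernel_def using ne \<rho> K
      by (intro integrable_continuous_interval continuous_intros cf) (auto simp: norm_mult)
  qed (use I K \<rho> in \<open>auto simp: pk norm_mult\<close>)
  then show ?thesis
    using K by (simp add: Fw norm_mult norm_divide norm_power field_simps)
qed

text \<open>The case of Littlewood's subordination principle that is needed for affine symbols: the Poisson
  bound is integrated over the inner circle, and after exchanging the integrals the mean value
  property replaces the kernel at the moving point by the kernel at the centre \<open>c\<close>.\<close>

lemma circle_integral_off_center_le:
  assumes hol: "f holomorphic_on ball 0 1" and q: "0 \<le> q" and c: "cmod c + q < \<rho>" and \<rho>1: "\<rho> < 1"
  shows "integral {0..2 * pi} (\<lambda>s. (cmod (f (c + of_real q * cis s)))\<^sup>2)
     \<le> (\<rho> + cmod c) / (\<rho> - cmod c) * integral {0..2 * pi} (\<lambda>t. (cmod (f (of_real \<rho> * cis t)))\<^sup>2)"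
proof -
  have \<rho>: "0 < \<rho>" using q c norm_ge_zero[of c] by linarith
  define w where "w s = c + of_real q * cis s" for s
  define \<zeta> where "\<zeta> t = of_real \<rho> * cis t" for t
  have w: "cmod (w s) < \<rho>" for s
    using norm_triangle_ineq[of c "of_real q * cis s"] q c by (simp add: w_def norm_mult)
  have \<zeta>: "cmod (\<zeta> t) = \<rho>" for t using \<rho> by (simp add: \<zeta>_def norm_mult)
  have ne: "\<zeta> t \<noteq> w s" for s t using w[of s] \<zeta>[of t] by auto
  have cw: "continuous_on S w" "continuous_on S \<zeta>" for S unfolding w_def \<zeta>_def by (intro continuous_intros)+
  have cf: "continuous_on (ball 0 1) f" using hol by (rule holomorphic_on_imp_continuous_on)
  have "w s \<in> ball 0 1" "\<zeta> s \<in> ball 0 1" for s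
    using w[of s] \<zeta>[of s] \<rho>1 by auto
  then have cfw: "continuous_on S (\<lambda>s. f (w s))" "continuous_on S (\<lambda>s. f (\<zeta> s))" for S
    using continuous_on_compose2[OF cf cw(1)] continuous_on_compose2[OF cf cw(2)] by blast+
  define G where "G s t = (cmod (f (\<zeta> t)))\<^sup>2 * poisson_kernel (\<zeta> t) (w s)" for s t
  have cG: "continuous_on S (\<lambda>(s,t). G s t)" for S
    unfolding G_def poisson_kernel_def case_prod_beta
    using ne
    by (intro continuous_intros continuous_on_compose2[OF cfw(2)[of UNIV], where f = snd]
        continuous_on_compose2[OF cw(1)[of UNIV], where f = fst] continuous_on_compose2[OF cw(2)[of UNIV], where f = snd]) auto
  have int1: "(\<lambda>s. integral {0..2 * pi} (G s)) integrable_on {0..2*pi}"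
    using integral_continuous_on_param[of "{0..2*pi}" 0 "2*pi" G] cG
    by (intro integrable_continuous_interval) auto
  have "2 * pi * integral {0..2 * pi} (\<lambda>s. (cmod (f (w s)))\<^sup>2)
      = integral {0..2 * pi} (\<lambda>s. 2 * pi * (cmod (f (w s)))\<^sup>2)"
    by simp
  also have "\<dots> \<le> integral {0..2 * pi} (\<lambda>s. integral {0..2 * pi} (G s))"
  proof (rule integral_le)
    show "(\<lambda>s. 2 * pi * (cmod (f (w s)))\<^sup>2) integrable_on {0..2*pi}"
      by (intro integrable_continuous_interval continuous_intros cfw)
    show "2 * pi * (cmod (f (w s)))\<^sup>2 \<le> integral {0..2 * pi} (G s)" for s
      using square_le_poisson_integral[OF hol \<rho>1 w] unfolding G_def \<zeta>_def .
  qed (rule int1)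
  also have "\<dots> = integral {0..2 * pi} (\<lambda>t. integral {0..2 * pi} (\<lambda>s. G s t))"
    using integral_swap_continuous[of 0 0 "2*pi" "2*pi" G] cG by simp
  also have "\<dots> = integral {0..2 * pi} (\<lambda>t. (cmod (f (\<zeta> t)))\<^sup>2 * (2 * pi * poisson_kernel (\<zeta> t) c))"
  proof (rule integral_cong)
    fix t
    show "integral {0..2 * pi} (\<lambda>s. G s t) = (cmod (f (\<zeta> t)))\<^sup>2 * (2 * pi * poisson_kernel (\<zeta> t) c)"
      using poisson_kernel_mean_value[OF q, of c "\<zeta> t"] c \<zeta> unfolding G_def w_def
      by (simp add: integral_unique)
  qed
  also have "\<dots> \<le> integral {0..2 * pi} (\<lambda>t. (cmod (f (\<zeta> t)))\<^sup>2 * (2 * pi * ((\<rho> + cmod c) / (\<rho> - cmod c))))"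
  proof (rule integral_le)
    have "\<zeta> t \<noteq> c" for t using \<zeta>[of t] c q by auto
    then show "(\<lambda>t. (cmod (f (\<zeta> t)))\<^sup>2 * (2 * pi * poisson_kernel (\<zeta> t) c)) integrable_on {0..2*pi}"
      unfolding poisson_kernel_def
      by (intro integrable_continuous_interval continuous_intros cfw cw) auto
    show "(\<lambda>t. (cmod (f (\<zeta> t)))\<^sup>2 * (2 * pi * ((\<rho> + cmod c) / (\<rho> - cmod c)))) integrable_on {0..2*pi}"
      by (intro integrable_continuous_interval continuous_intros cfw)
    show "(cmod (f (\<zeta> t)))\<^sup>2 * (2 * pi * poisson_kernel (\<zeta> t) c)
        \<le> (cmod (f (\<zeta> t)))\<^sup>2 * (2 * pi * ((\<rho> + cmod c) / (\<rho> - cmod c)))" for t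
      using poisson_kernel_le[of c "\<zeta> t"] c q \<zeta> by (intro mult_left_mono) auto
  qed
  also have "\<dots> = 2 * pi * ((\<rho> + cmod c) / (\<rho> - cmod c) * integral {0..2 * pi} (\<lambda>t. (cmod (f (\<zeta> t)))\<^sup>2))"
    by (subst integral_mult_left) (simp only: mult_ac)
  finally have "2 * pi * integral {0..2 * pi} (\<lambda>s. (cmod (f (w s)))\<^sup>2)
    \<le> 2 * pi * ((\<rho> + cmod c) / (\<rho> - cmod c) * integral {0..2 * pi} (\<lambda>t. (cmod (f (\<zeta> t)))\<^sup>2))" .
  then show ?thesis
    unfolding w_def \<zeta>_def by (rule mult_left_le_imp_le) simp
qed

section \<open>Bounded operators and closures in the Hardy space\<close>

lemma hardy2_norm_le:
  assumes "0 \<le> B" "\<And>r. 0 \<le> r \<Longrightarrow> r < 1 \<Longrightarrow> circle_mean f r \<le> B\<^sup>2"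
  shows "hardy2_norm f \<le> B"
proof -
  have "(SUP r\<in>{0..<1}. circle_mean f r) \<le> B\<^sup>2"
    using assms(2) by (intro cSUP_least) auto
  then show ?thesis
    unfolding hardy2_norm_def using assms(1) by (simp add: real_le_lsqrt)
qed

lemma circle_mean_scale: "circle_mean (cfun_scale c f) r = (cmod c)\<^sup>2 * circle_mean f r"
  by (simp add: circle_mean_def cfun_scale_def norm_mult power_mult_distrib)

lemma hardy2_scale:
  assumes f: "f \<in> hardy2"
  shows "cfun_scale c f \<in> hardy2"
proof -
  have "bdd_above (circle_mean (cfun_scale c f) ` {0..<1})"
    using circle_mean_le_norm[OF f]
    by (intro bdd_aboveI[of _ "(cmod c)\<^sup>2 * (hardy2_norm f)\<^sup>2"]) (auto simp: circle_mean_scale intro!: mult_left_mono)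
  then show ?thesis
    using f by (auto simp: hardy2_def cfun_scale_def intro!: holomorphic_intros)
qed

lemma hardy2_norm_scale_le:
  assumes f: "f \<in> hardy2"
  shows "hardy2_norm (cfun_scale c f) \<le> cmod c * hardy2_norm f"
  using circle_mean_le_norm[OF f] hardy2_norm_nonneg[OF f]
  by (intro hardy2_norm_le) (auto simp: circle_mean_scale power_mult_distrib intro!: mult_left_mono)

lemma zero_in_hardy2: "0 \<in> hardy2"
proof -
  have "circle_mean 0 r = 0" for r by (simp add: circle_mean_def)
  then show ?thesis by (auto simp: hardy2_def zero_fun_def intro!: bdd_aboveI[of _ 0])
qed

text \<open>Closure under addition reduces to closure under differences, as \<open>f + g = f - (0 - g)\<close>.\<close>

lemma subspace_hardy2: "cfun_subspace hardy2"
proof (rule cfun.subspaceI[OF zero_in_hardy2 _ hardy2_scale])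
  fix f g assume "f \<in> hardy2" "g \<in> hardy2"
  then have "f - (0 - g) \<in> hardy2" by (intro hardy2_diff zero_in_hardy2)
  then show "f + g \<in> hardy2" by simp
qed

lemma in_hardy2_closure_iff:
  "f \<in> hardy2.mtopology closure_of S \<longleftrightarrow>
     f \<in> hardy2 \<and> (\<forall>e>0. \<exists>g\<in>S. g \<in> hardy2 \<and> hardy2_norm (f - g) < e)"
  unfolding hardy2.metric_closure_of hardy2.mball_def
  by (auto simp: hardy2_dist_def; meson)

text \<open>Linearity is required of all functions, not only of those in the Hardy space: it holds in that
  generality both for composition operators and for multiplication by a scalar.\<close>

locale bounded_hardy_operator =
  fixes T :: "(complex \<Rightarrow> complex) \<Rightarrow> complex \<Rightarrow> complex" and C :: real
  assumes add: "T (f + g) = T f + T g"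
    and scale: "T (cfun_scale c f) = cfun_scale c (T f)"
    and maps_to: "f \<in> hardy2 \<Longrightarrow> T f \<in> hardy2"
    and bounded: "f \<in> hardy2 \<Longrightarrow> hardy2_norm (T f) \<le> C * hardy2_norm f"
begin

lemma diff: "T (f - g) = T f - T g"
  using add[of "f - g" g] by (simp add: algebra_simps)

lemma closure_invariant:
  assumes "T ` V \<subseteq> V"
  shows "T ` (hardy2.mtopology closure_of V) \<subseteq> hardy2.mtopology closure_of V"
proof clarify
  fix f assume f: "f \<in> hardy2.mtopology closure_of V"
  show "T f \<in> hardy2.mtopology closure_of V"
    unfolding in_hardy2_closure_iff
  proof (intro conjI allI impI)
    show "T f \<in> hardy2" using f maps_to in_hardy2_closure_iff by blast
    fix e :: real assume e: "e > 0"
    \<comment> \<open>\<open>C\<close> may be \<open>0\<close>; a positive bound is needed to divide by.\<close>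
    define B where "B = max C 1"
    have B: "B > 0" "C \<le> B" by (auto simp: B_def)
    obtain g where g: "g \<in> V" "g \<in> hardy2" "hardy2_norm (f - g) < e / B"
      using f e B unfolding in_hardy2_closure_iff by (meson divide_pos_pos)
    have fg: "f - g \<in> hardy2" using f g hardy2_diff in_hardy2_closure_iff by blast
    have "hardy2_norm (T f - T g) \<le> C * hardy2_norm (f - g)"
      using bounded[OF fg] by (simp add: diff)
    also have "\<dots> \<le> B * hardy2_norm (f - g)"
      using B hardy2_norm_nonneg[OF fg] by (intro mult_right_mono)
    also have "\<dots> < e" using g B by (simp add: field_simps)
    finally show "\<exists>g\<in>V. g \<in> hardy2 \<and> hardy2_norm (T f - g) < e"
      using g assms maps_to by blast
  qed
qed

end

text \<open>Multiplication by a scalar is itself such an operator, which makes \<open>closure_invariant\<close> available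
  for the scalar multiples in the closure of a subspace.\<close>

lemma scale_bounded_hardy_operator: "bounded_hardy_operator (cfun_scale c) (cmod c)"
  by unfold_locales
    (auto simp: cfun.scale_right_distrib cfun.scale_left_commute hardy2_scale hardy2_norm_scale_le)

lemma subspace_closure:
  assumes V: "cfun_subspace V"
  shows "cfun_subspace (hardy2.mtopology closure_of V)"
proof (rule cfun.subspaceI)
  show "0 \<in> hardy2.mtopology closure_of V"
    using cfun.subspace_0[OF V] zero_in_hardy2 hardy2_norm_zero
    by (auto simp: in_hardy2_closure_iff intro!: bexI[of _ 0])
next
  fix c f assume "f \<in> hardy2.mtopology closure_of V"
  then show "cfun_scale c f \<in> hardy2.mtopology closure_of V"
    using bounded_hardy_operator.closure_invariant[OF scale_bounded_hardy_operator, of c V]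
      cfun.subspace_scale[OF V] by blast
next
  fix f g assume f: "f \<in> hardy2.mtopology closure_of V" and g: "g \<in> hardy2.mtopology closure_of V"
  show "f + g \<in> hardy2.mtopology closure_of V"
    unfolding in_hardy2_closure_iff
  proof (intro conjI allI impI)
    show "f + g \<in> hardy2"
      using f g cfun.subspace_add[OF subspace_hardy2] in_hardy2_closure_iff by blast
    fix e :: real assume "e > 0"
    then have "e / 2 > 0" by simp
    then obtain f' g' where f': "f' \<in> V" "f' \<in> hardy2" "hardy2_norm (f - f') < e / 2"
      and g': "g' \<in> V" "g' \<in> hardy2" "hardy2_norm (g - g') < e / 2"
      using f g unfolding in_hardy2_closure_iff by meson
    have "hardy2_norm ((f - f') - (g' - g)) \<le> hardy2_norm (f - f') + hardy2_norm (g' - g)"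
      using f g f' g' by (intro hardy2_norm_diff_le hardy2_diff) (auto simp: in_hardy2_closure_iff)
    also have "\<dots> < e" using f' g' hardy2_norm_minus_commute[of g g'] by simp
    also have "(f - f') - (g' - g) = f + g - (f' + g')" by simp
    finally show "\<exists>h\<in>V. h \<in> hardy2 \<and> hardy2_norm (f + g - h) < e"
      using f' g' cfun.subspace_add[OF V] cfun.subspace_add[OF subspace_hardy2] by blast
  qed
qed

section \<open>Cyclic and minimal invariant subspaces\<close>

context bounded_hardy_operator
begin

lemma orbit_subset:
  assumes "f \<in> N" "T ` N \<subseteq> N"
  shows "{(T ^^ n) f |n. True} \<subseteq> N"
proof -
  have "(T ^^ n) f \<in> N" for n
    using assms by (induction n) auto
  then show ?thesis by auto
qed

lemma span_orbit_invariant: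
  "T ` cfun_span {(T ^^ n) f |n. True} \<subseteq> cfun_span {(T ^^ n) f |n. True}" (is "T ` cfun_span ?O \<subseteq> _")
proof clarify
  fix g assume "g \<in> cfun_span ?O"
  then show "T g \<in> cfun_span ?O"
  proof (induction rule: cfun.span_induct_alt)
    case base
    have "T 0 = 0" using diff[of 0 0] by simp
    show ?case unfolding \<open>T 0 = 0\<close> by (rule cfun.span_zero)
  next
    case (step c x y)
    then obtain n where "x = (T ^^ n) f" by auto
    then have "T x = (T ^^ Suc n) f" by simp
    then have "T x \<in> cfun_span ?O" by (blast intro: cfun.span_base)
    then show ?case
      unfolding add scale by (intro cfun.span_add cfun.span_scale step.IH)
  qed
qed

text \<open>Boundedness enters here, through \<open>closure_invariant\<close>: invariance of the span passes to its closure.\<close>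

lemma cyclic_subspace_invariant: "invariant_subspace T (cyclic_subspace T f)"
  unfolding invariant_subspace_def cyclic_subspace_def
  by (intro conjI subspace_closure closure_invariant span_orbit_invariant cfun.subspace_span
      closedin_closure_of)

lemma generator_in_cyclic_subspace:
  assumes "f \<in> hardy2"
  shows "f \<in> cyclic_subspace T f"
proof -
  have "f = (T ^^ 0) f" by simp
  then have "f \<in> cfun_span {(T ^^ n) f |n. True}" by (intro cfun.span_base) blast
  moreover have "{(T ^^ n) f |n. True} \<subseteq> hardy2"
    using assms maps_to by (intro orbit_subset) auto
  ultimately show ?thesis
    unfolding cyclic_subspace_def in_hardy2_closure_iff
    using assms hardy2_norm_zero by (auto intro!: bexI[of _ f])
qed

lemma cyclic_subspace_least:
  assumes N: "invariant_subspace T N" and f: "f \<in> N"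
  shows "cyclic_subspace T f \<subseteq> N"
proof -
  have "cfun_span {(T ^^ n) f |n. True} \<subseteq> N"
    using N f by (intro cfun.span_minimal orbit_subset) (auto simp: invariant_subspace_def)
  then show ?thesis
    using N unfolding cyclic_subspace_def by (intro closure_of_minimal) (auto simp: invariant_subspace_def)
qed

text \<open>The cyclic subspace of \<open>g\<close> lies in \<open>M\<close> and contains \<open>g \<noteq> 0\<close>, so minimality leaves only \<open>M\<close>.\<close>

lemma minimal_invariant_subspace_cyclic:
  assumes M: "minimal_invariant_subspace T M" and g: "g \<in> M" "g \<noteq> 0"
  shows "cyclic_subspace T g = M"
proof -
  have inv: "invariant_subspace T M" using M by (simp add: minimal_invariant_subspace_def)
  then have "M \<subseteq> hardy2"
    using closedin_subset[of hardy2.mtopology M] by (simp add: invariant_subspace_def)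
  then have "cyclic_subspace T g \<noteq> {0}"
    using g generator_in_cyclic_subspace[of g] by blast
  moreover have "cyclic_subspace T g \<subseteq> M"
    by (rule cyclic_subspace_least[OF inv g(1)])
  ultimately show ?thesis
    using M cyclic_subspace_invariant unfolding minimal_invariant_subspace_def by blast
qed

end

section \<open>Composition with affine symbols\<close>

text \<open>Everything is expressed relative to the fixed point \<open>1\<close> of the symbol:
  \<open>\<phi>\<^sub>c(z) = 1 - c (1 - z)\<close>.\<close>

lemma cmod_affine_symbol_square:
  "(cmod (affine_symbol c z))\<^sup>2 = 1 - c * (2 * Re (1 - z) - c * (cmod (1 - z))\<^sup>2)"
  unfolding affine_symbol_def cmod_power2 by (simp add: power2_eq_square algebra_simps)

text \<open>The preimage of the unit disk increases as \<open>c\<close> decreases; this form of the condition makes the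
  dependence on \<open>c\<close> explicit.\<close>

lemma affine_symbol_in_ball_iff:
  assumes "0 < c"
  shows "affine_symbol c z \<in> ball 0 1 \<longleftrightarrow> c * (cmod (1 - z))\<^sup>2 < 2 * Re (1 - z)"
proof -
  have "affine_symbol c z \<in> ball 0 1 \<longleftrightarrow> (cmod (affine_symbol c z))\<^sup>2 < 1"
    by (simp add: abs_square_less_1)
  then show ?thesis
    using assms unfolding cmod_affine_symbol_square by (simp add: zero_less_mult_iff)
qed

text \<open>This is the criterion above for \<open>c = 1\<close>, where the symbol is the identity.\<close>

lemma in_disk_iff:
  "z \<in> ball 0 1 \<longleftrightarrow> (cmod (1 - z))\<^sup>2 < 2 * Re (1 - z)"
  using affine_symbol_in_ball_iff[of 1 z] by (simp add: affine_symbol_def)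

lemma affine_symbol_maps_disk:
  assumes "0 < c" "c \<le> 1" "z \<in> ball 0 1"
  shows "affine_symbol c z \<in> ball 0 1"
proof -
  have "c * (cmod (1 - z))\<^sup>2 \<le> 1 * (cmod (1 - z))\<^sup>2"
    using assms by (intro mult_right_mono) auto
  then show ?thesis
    using assms(3) in_disk_iff[of z] affine_symbol_in_ball_iff[OF assms(1), of z] by linarith
qed

lemma holomorphic_on_comp_affine_symbol:
  assumes "f holomorphic_on ball 0 1"
  shows "f \<circ> affine_symbol c holomorphic_on affine_symbol c -` ball 0 1"
proof (rule holomorphic_on_compose_gen[OF _ assms])
  show "affine_symbol c holomorphic_on affine_symbol c -` ball 0 1"
    unfolding affine_symbol_def [abs_def] by (intro holomorphic_intros)
qed auto

text \<open>The composed function runs over the circle with centre \<open>1 - a\<close> and radius \<open>a r\<close>, which is compared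
  with a circle of radius \<open>\<rho>\<close> about the origin.\<close>

lemma circle_mean_comp_affine_symbol_le:
  assumes a: "0 < a" "a < 1" and f: "f \<in> hardy2" and r: "0 \<le> r" "r < 1"
  shows "circle_mean (comp_op (affine_symbol a) f) r \<le> 4 / a * (hardy2_norm f)\<^sup>2"
proof -
  \<comment> \<open>The midpoint between the farthest point of the inner circle and \<open>1\<close> keeps \<open>\<rho> - (1 - a)\<close> above
    \<open>a / 2\<close>, so that the Harnack constant is bounded uniformly in \<open>r\<close>.\<close>
  define \<rho> where "\<rho> = (1 + ((1 - a) + a * r)) / 2"
  have ar: "a * r < a" "0 \<le> a * r" using a r by auto
  have \<rho>: "(1 - a) + a * r < \<rho>" "\<rho> < 1" "a / 2 \<le> \<rho> - (1 - a)" "0 \<le> \<rho>"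
    using a ar by (auto simp: \<rho>_def field_simps)
  have nc: "cmod (1 - of_real a) = 1 - a"
    using a by (metis norm_of_real of_real_1 of_real_diff abs_of_nonneg diff_ge_0_iff_ge less_imp_le)
  have "circle_mean (comp_op (affine_symbol a) f) r
    = integral {0..2 * pi} (\<lambda>s. (cmod (f ((1 - of_real a) + of_real (a * r) * cis s)))\<^sup>2) / (2 * pi)"
    using r by (simp add: circle_mean_def comp_op_def affine_symbol_def norm_mult add.commute mult.assoc)
  also have "\<dots> \<le> (\<rho> + (1 - a)) / (\<rho> - (1 - a))
     * integral {0..2 * pi} (\<lambda>t. (cmod (f (of_real \<rho> * cis t)))\<^sup>2) / (2 * pi)"
    using f \<rho> ar circle_integral_off_center_le[of f "a * r" "1 - of_real a" \<rho>]
    unfolding nc by (intro divide_right_mono) (auto simp: hardy2_def)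
  also have "\<dots> = (\<rho> + (1 - a)) / (\<rho> - (1 - a)) * circle_mean f \<rho>"
    by (simp add: circle_mean_def)
  also have "\<dots> \<le> 2 / (a / 2) * (hardy2_norm f)\<^sup>2"
    using a \<rho> circle_mean_le_norm[OF f] circle_mean_nonneg
    by (intro mult_mono frac_le) auto
  finally show ?thesis by simp
qed

lemma comp_affine_symbol_bounded:
  assumes a: "0 < a" "a < 1"
  shows "bounded_hardy_operator (comp_op (affine_symbol a)) (sqrt (4 / a))"
proof
  fix f g c
  show "comp_op (affine_symbol a) (f + g) = comp_op (affine_symbol a) f + comp_op (affine_symbol a) g"
    "comp_op (affine_symbol a) (cfun_scale c f) = cfun_scale c (comp_op (affine_symbol a) f)"
    by (auto simp: comp_op_def cfun_scale_def)
  assume f: "f \<in> hardy2"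
  have "f \<circ> affine_symbol a holomorphic_on ball 0 1"
    by (rule holomorphic_on_subset[OF holomorphic_on_comp_affine_symbol])
      (use f a affine_symbol_maps_disk[of a] in \<open>auto simp: hardy2_def\<close>)
  then have "comp_op (affine_symbol a) f holomorphic_on ball 0 1"
    by (rule holomorphic_transform) (simp add: comp_op_def)
  moreover have "bdd_above (circle_mean (comp_op (affine_symbol a) f) ` {0..<1})"
    using circle_mean_comp_affine_symbol_le[OF a f] by (intro bdd_aboveI) auto
  ultimately show "comp_op (affine_symbol a) f \<in> hardy2"
    by (simp add: hardy2_def comp_op_def)
  show "hardy2_norm (comp_op (affine_symbol a) f) \<le> sqrt (4 / a) * hardy2_norm f"
    using circle_mean_comp_affine_symbol_le[OF a f] a hardy2_norm_nonneg[OF f]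
    by (intro hardy2_norm_le) (auto simp: power_mult_distrib)
qed

text \<open>For \<open>n = 0\<close> the right-hand side cuts \<open>f\<close> off outside the disk, where elements of the Hardy space
  vanish by convention.\<close>

lemma comp_affine_symbol_funpow:
  assumes a: "0 < a" "a < 1" and f: "f \<in> hardy2"
  shows "(comp_op (affine_symbol a) ^^ n) f = comp_op (affine_symbol (a ^ n)) f"
proof (induction n)
  case 0
  then show ?case using f by (auto simp: comp_op_def affine_symbol_def hardy2_def)
next
  case (Suc n)
  have "affine_symbol (a ^ n) (affine_symbol a z) = affine_symbol (a ^ Suc n) z" for z
    by (simp add: affine_symbol_def algebra_simps)
  then have "comp_op (affine_symbol a) (comp_op (affine_symbol (a ^ n)) f)
      = comp_op (affine_symbol (a ^ Suc n)) f"
    using affine_symbol_maps_disk[of a] a by (auto simp: comp_op_def)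
  then show ?case
    by (simp add: Suc)
qed

text \<open>The identity theorem applies: \<open>f\<close> vanishes on the image of the disk, which is open.\<close>

lemma comp_affine_symbol_eq_0D:
  assumes c: "0 < c" "c \<le> 1" and f: "f \<in> hardy2" and 0: "comp_op (affine_symbol c) f = 0"
  shows "f = 0"
proof
  fix z
  show "f z = 0 z"
  proof (cases "z \<in> ball 0 1")
    case True
    define A where "A = affine_symbol c ` ball 0 1"
    have inj: "inj_on (affine_symbol c) (ball 0 1)"
      using c by (auto simp: inj_on_def affine_symbol_def)
    have "open A" unfolding A_def
      using inj by (intro open_mapping_thm3) (auto simp: affine_symbol_def[abs_def] intro!: holomorphic_intros)
    moreover have "f w = 0" if "w \<in> A" for w
    proof -
      from that obtain z where z: "z \<in> ball 0 1" "w = affine_symbol c z" by (auto simp: A_def)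
      then show ?thesis using fun_cong[OF 0, of z] by (simp add: comp_op_def)
    qed
    ultimately show ?thesis
      using True f affine_symbol_maps_disk[OF c]
      by (intro analytic_continuation_open[of A "ball 0 1" f "\<lambda>_. 0" z, THEN trans])
        (auto simp: A_def hardy2_def)
  next
    case False
    then show ?thesis using f by (simp add: hardy2_def)
  qed
qed

section \<open>The domain of the extended generator\<close>

text \<open>For \<open>c = 1\<close> the condition of \<open>affine_symbol_in_ball_iff\<close> holds on the closed disk with \<open>\<le>\<close>; a
  smaller \<open>c\<close> makes it strict except at \<open>z = 1\<close>, where both sides vanish.\<close>

lemma cball_subset_affine_vimage:
  assumes "0 < c" "c < 1"
  shows "cball 0 1 - {1} \<subseteq> affine_symbol c -` ball 0 1"
proof
  fix z :: complex assume z: "z \<in> cball 0 1 - {1}"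
  have "(cmod z)\<^sup>2 \<le> 1" using z by (simp add: abs_square_le_1)
  moreover have "(cmod (1 - z))\<^sup>2 = 2 * Re (1 - z) - 1 + (cmod z)\<^sup>2"
    unfolding cmod_power2 by (simp add: power2_eq_square algebra_simps)
  moreover have "c * (cmod (1 - z))\<^sup>2 < 1 * (cmod (1 - z))\<^sup>2"
    using assms z by (intro mult_strict_right_mono) auto
  ultimately have "c * (cmod (1 - z))\<^sup>2 < 2 * Re (1 - z)"
    by linarith
  then show "z \<in> affine_symbol c -` ball 0 1"
    using assms by (simp only: vimage_eq affine_symbol_in_ball_iff)
qed

text \<open>On a compact subset of the half-plane the quotient \<open>\<bar>1 - z\<bar>\<^sup>2 / (2 Re (1 - z))\<close> is bounded, and \<open>z\<close> lies
  in the preimage of the disk as soon as \<open>a\<^sup>n\<close> times this quotient is below \<open>1\<close>.\<close>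

lemma compact_subset_affine_vimage:
  assumes a: "0 < a" "a < 1" and L: "compact L" "L \<subseteq> {z. Re z < 1}"
  obtains n where "n > 0" "L \<subseteq> affine_symbol (a ^ n) -` ball 0 1"
proof -
  obtain B where B: "0 < B" "\<And>z. z \<in> L \<Longrightarrow> (cmod (1 - z))\<^sup>2 / (2 * Re (1 - z)) < B"
  proof -
    have "continuous_on L (\<lambda>z. (cmod (1 - z))\<^sup>2 / (2 * Re (1 - z)))"
      using L by (intro continuous_intros) auto
    then have "bounded ((\<lambda>z. (cmod (1 - z))\<^sup>2 / (2 * Re (1 - z))) ` L)"
      using L by (intro compact_imp_bounded compact_continuous_image)
    then show ?thesis
      using that unfolding bounded_pos_less by (fastforce simp: abs_less_iff)
  qed
  obtain n where n: "a ^ n < 1 / B"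
    using real_arch_pow_inv[of "1 / B" a] a B by auto
  \<comment> \<open>A positive exponent guarantees that the power of \<open>a\<close> is strictly below \<open>1\<close>.\<close>
  have "a ^ Suc n * B < 1"
  proof -
    have "a ^ Suc n \<le> a ^ n" using a by (intro power_decreasing) auto
    with n have "a ^ Suc n < 1 / B" by linarith
    then show ?thesis using B by (simp add: field_simps)
  qed
  moreover have "affine_symbol (a ^ Suc n) z \<in> ball 0 1" if "z \<in> L" for z
  proof -
    have pos: "Re (1 - z) > 0" using L that by auto
    have "(cmod (1 - z))\<^sup>2 < B * (2 * Re (1 - z))"
      using B(2)[OF that] pos by (simp add: pos_divide_less_eq)
    then have "a ^ Suc n * (cmod (1 - z))\<^sup>2 \<le> a ^ Suc n * (B * (2 * Re (1 - z)))"
      using a by (intro mult_left_mono) auto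
    also have "\<dots> = (a ^ Suc n * B) * (2 * Re (1 - z))" by (simp only: mult_ac)
    also have "\<dots> < 1 * (2 * Re (1 - z))"
      using calculation \<open>a ^ Suc n * B < 1\<close> pos by (intro mult_strict_right_mono) auto
    finally show ?thesis
      using a by (subst affine_symbol_in_ball_iff) auto
  qed
  ultimately show ?thesis using that[of "Suc n"] by blast
qed

section \<open>Analytic generators of minimal invariant subspaces\<close>

theorem proposition17:
  fixes a :: real and f :: "complex \<Rightarrow> complex"
  assumes "0 < a" and "a < 1"
    and "f \<in> hardy2" and "f \<noteq> 0"
    and "minimal_invariant_subspace (comp_op (affine_symbol a))
           (cyclic_subspace (comp_op (affine_symbol a)) f)"
  shows "(\<exists>g V. g \<in> hardy2 \<and>
            cyclic_subspace (comp_op (affine_symbol a)) g =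
              cyclic_subspace (comp_op (affine_symbol a)) f \<and>
            open V \<and> cball 0 1 - {1} \<subseteq> V \<and> extends_analytically g V) \<and>
         (\<forall>L. compact L \<and> L \<subseteq> {z. Re z < 1} \<longrightarrow>
           (\<exists>g V. g \<in> hardy2 \<and>
              cyclic_subspace (comp_op (affine_symbol a)) g =
                cyclic_subspace (comp_op (affine_symbol a)) f \<and>
              open V \<and> cball 0 1 - {1} \<subseteq> V \<and> L \<subseteq> V \<and> extends_analytically g V))"
proof -
  let ?T = "comp_op (affine_symbol a)"
  note a = assms(1,2) and f = assms(3)
  interpret bounded_hardy_operator ?T "sqrt (4 / a)"
    by (rule comp_affine_symbol_bounded[OF a])
  have hol: "f holomorphic_on ball 0 1" using f by (simp add: hardy2_def)
  have main: "\<exists>g V. g \<in> hardy2 \<and> cyclic_subspace ?T g = cyclic_subspace ?T f \<and>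
      open V \<and> cball 0 1 - {1} \<subseteq> V \<and> L \<subseteq> V \<and> extends_analytically g V"
    if L: "compact L" "L \<subseteq> {z. Re z < 1}" for L
  proof -
    obtain n where n: "n > 0" and LV: "L \<subseteq> affine_symbol (a ^ n) -` ball 0 1"
      using compact_subset_affine_vimage[OF a L] .
    have c: "0 < a ^ n" "a ^ n < 1" using a n by (auto simp: power_less_one_iff)
    define V where "V = affine_symbol (a ^ n) -` ball 0 1"
    define g where "g = comp_op (affine_symbol (a ^ n)) f"
    have g_pow: "g = (?T ^^ n) f"
      by (simp add: g_def comp_affine_symbol_funpow[OF a f])
    have "g \<in> cyclic_subspace ?T f"
      using orbit_subset[of f "cyclic_subspace ?T f"] generator_in_cyclic_subspace[OF f]
        cyclic_subspace_invariant[of f] by (auto simp: g_pow invariant_subspace_def)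
    moreover have "g \<noteq> 0"
      using comp_affine_symbol_eq_0D[of "a ^ n" f] c f assms(4) by (auto simp: g_def)
    ultimately have "cyclic_subspace ?T g = cyclic_subspace ?T f"
      by (rule minimal_invariant_subspace_cyclic[OF assms(5)])
    moreover have "g \<in> hardy2"
      using orbit_subset[of f hardy2] f maps_to by (auto simp: g_pow)
    moreover have V: "open V"
      unfolding V_def affine_symbol_def[abs_def] by (intro open_vimage continuous_intros) auto
    moreover have "cball 0 1 - {1} \<subseteq> V"
      unfolding V_def by (rule cball_subset_affine_vimage[OF c])
    moreover have "extends_analytically g V"
      unfolding extends_analytically_def
    proof (intro exI[of _ "f \<circ> affine_symbol (a ^ n)"] conjI ballI)
      show "f \<circ> affine_symbol (a ^ n) analytic_on V"
        using V holomorphic_on_comp_affine_symbol[OF hol, of "a ^ n"]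
        by (simp add: V_def analytic_on_open)
    qed (simp add: g_def comp_op_def)
    ultimately show ?thesis using LV V_def by blast
  qed
  show ?thesis
  proof (intro conjI allI impI)
    show "\<exists>g V. g \<in> hardy2 \<and> cyclic_subspace ?T g = cyclic_subspace ?T f \<and>
        open V \<and> cball 0 1 - {1} \<subseteq> V \<and> extends_analytically g V"
      using main[of "{}"] by auto
  qed (use main in auto)
qed
end
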